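(* Every interval $[u,v]$ of a finite semidistrim lattice is a semidistrim lattice.
   Context: All lattices are finite. For a lattice $L$, $\mathcal{J}_L$ (resp. $\mathcal{M}_L$) is the set of join-irreducible (resp. meet-irreducible) elements; for $j\in\mathcal{J}_L$, $j_*$ is the unique element covered by $j$, and for $m\in\mathcal{M}_L$, $m^*$ is the unique element covering $m$. Let $\mathcal{M}_L(j)=\max\{z\in L: j_*=j\wedge z\}$ and $\mathcal{J}_L(m)=\min\{z\in L: m^*=m\vee z\}$. A pairing on $L$ is a bijection $\kappa:\mathcal{J}_L\to\mathcal{M}_L$ with $\kappa(j)\in\mathcal{M}_L(j)$ for all $j$ and $\kappa^{-1}(m)\in\mathcal{J}_L(m)$ for all $m$; $L$ is uniquely paired if it has exactly one pairing, denoted $\kappa_L$. A prime pair is a pair $(j_0,m_0)$ with $L=[\hat0,m_0]\sqcup[j_0,\hat1]$. A uniquely paired lattice $L$ is compatibly dismantlable if $|L|=1$ or there is a prime pair $(j_0,m_0)$ such that: (i) $[j_0,\hat1]$ is compatibly dismantlable and $\alpha(j)=j_0\vee j$ defines a bijection $\{j\in\mathcal{J}_L: j_0\le\kappa_L(j)\}\to\mathcal{J}_{[j_0,\hat1]}$ with $\kappa_{[j_0,\hat1]}(\alpha(j))=\kappa_L(j)$; (ii) $[\hat0,m_0]$ is compatibly dismantlable and $\beta(m)=m_0\wedge m$ defines a bijection $\{m\in\mathcal{M}_L:\kappa_L^{-1}(m)\le m_0\}\to\mathcal{M}_{[\hat0,m_0]}$ with $\kappa_{[\hat0,m_0]}^{-1}(\beta(m))=\kappa_L^{-1}(m)$.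 The Galois graph $G_L$ is the directed graph on $\mathcal{J}_L$ with an edge $j\to j'$ iff $j\ne j'$ and $j\not\le\kappa_L(j')$. For $x\in L$ let $J_L(x)=\{j\in\mathcal{J}_L:j\le x\}$ and $M_L(x)=\{j\in\mathcal{J}_L:\kappa_L(j)\ge x\}$. For a compatibly dismantlable $L$, for every cover $x\lessdot y$ the set $M_L(x)\cap J_L(y)$ has exactly one element $j_{xy}$; set $\mathcal{D}_L(x)=\{j_{yx}:y\lessdot x\}$ and $\mathcal{U}_L(x)=\{j_{xy}:x\lessdot y\}$. $L$ is semidistrim if it is compatibly dismantlable and $\mathcal{D}_L(x)$, $\mathcal{U}_L(x)$ are independent sets (no two elements adjacent) of $G_L$ for all $x\in L$. *)

theory Defs
  imports Main "HOL-Library.FuncSet"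
begin

text \<open>
  A finite lattice is given by its carrier: a finite nonempty subset \<open>L\<close> of a type of class
  \<^class>\<open>lattice\<close> that is closed under \<^const>\<open>inf\<close> and \<^const>\<open>sup\<close>. Hence order, meets and
  joins of \<open>L\<close> are those of the type, and an interval of \<open>L\<close> is a lattice of the same kind.
  An abstract finite lattice is the case \<open>L = UNIV\<close> over a finite type.
  All notions below (covers, irreducibility, ...) are relative to \<open>L\<close>, not to the type.
\<close>

definition finite_lattice_on :: "'a::lattice set \<Rightarrow> bool" where
  "finite_lattice_on L \<longleftrightarrow>
     finite L \<and> L \<noteq> {} \<and> (\<forall>x\<in>L. \<forall>y\<in>L. inf x y \<in> L \<and> sup x y \<in> L)"

definition interval_on :: "'a::lattice set \<Rightarrow> 'a \<Rightarrow> 'a \<Rightarrow> 'a set" where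
  "interval_on L u v = {z \<in> L. u \<le> z \<and> z \<le> v}"

definition covered_by :: "'a::lattice set \<Rightarrow> 'a \<Rightarrow> 'a \<Rightarrow> bool" where
  "covered_by L x y \<longleftrightarrow> x \<in> L \<and> y \<in> L \<and> x < y \<and> \<not> (\<exists>z\<in>L. x < z \<and> z < y)"

definition join_irreds :: "'a::lattice set \<Rightarrow> 'a set" where
  "join_irreds L = {j \<in> L. \<exists>!x. covered_by L x j}"

definition meet_irreds :: "'a::lattice set \<Rightarrow> 'a set" where
  "meet_irreds L = {m \<in> L. \<exists>!x. covered_by L m x}"

definition lower_star :: "'a::lattice set \<Rightarrow> 'a \<Rightarrow> 'a" where
  "lower_star L j = (THE x. covered_by L x j)"

definition upper_star :: "'a::lattice set \<Rightarrow> 'a \<Rightarrow> 'a" where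
  "upper_star L m = (THE x. covered_by L m x)"

definition maximal_elems :: "'a::lattice set \<Rightarrow> 'a set" where
  "maximal_elems A = {z \<in> A. \<not> (\<exists>y\<in>A. z < y)}"

definition minimal_elems :: "'a::lattice set \<Rightarrow> 'a set" where
  "minimal_elems A = {z \<in> A. \<not> (\<exists>y\<in>A. y < z)}"

text \<open>
  \<open>meet_partners L j\<close> is $\mathcal{M}_L(j)$ and \<open>join_partners L m\<close> is $\mathcal{J}_L(m)$; the
  ``max'' and ``min'' in their definitions denote the sets of maximal and minimal elements.
\<close>

definition meet_partners :: "'a::lattice set \<Rightarrow> 'a \<Rightarrow> 'a set" where
  "meet_partners L j = maximal_elems {z \<in> L. lower_star L j = inf j z}"

definition join_partners :: "'a::lattice set \<Rightarrow> 'a \<Rightarrow> 'a set" where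
  "join_partners L m = minimal_elems {z \<in> L. upper_star L m = sup m z}"

text \<open>
  A pairing is a function on \<open>join_irreds L\<close> only; \<^const>\<open>extensional\<close> fixes its values
  elsewhere, so that uniqueness of the pairing is uniqueness as a function on \<open>join_irreds L\<close>.
\<close>

definition pairing :: "'a::lattice set \<Rightarrow> ('a \<Rightarrow> 'a) \<Rightarrow> bool" where
  "pairing L \<kappa> \<longleftrightarrow>
     \<kappa> \<in> extensional (join_irreds L) \<and>
     bij_betw \<kappa> (join_irreds L) (meet_irreds L) \<and>
     (\<forall>j\<in>join_irreds L. \<kappa> j \<in> meet_partners L j) \<and>
     (\<forall>m\<in>meet_irreds L. inv_into (join_irreds L) \<kappa> m \<in> join_partners L m)"

definition uniquely_paired :: "'a::lattice set \<Rightarrow> bool" where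
  "uniquely_paired L \<longleftrightarrow> finite_lattice_on L \<and> (\<exists>!\<kappa>. pairing L \<kappa>)"

definition kappa :: "'a::lattice set \<Rightarrow> 'a \<Rightarrow> 'a" where
  "kappa L = (THE \<kappa>. pairing L \<kappa>)"

definition kappa_inv :: "'a::lattice set \<Rightarrow> 'a \<Rightarrow> 'a" where
  "kappa_inv L = inv_into (join_irreds L) (kappa L)"

text \<open>
  In a finite lattice \<open>L\<close> the intervals $[\hat 0, m]$ and $[j, \hat 1]$ are
  \<open>lower_interval L m\<close> and \<open>upper_interval L j\<close>.
\<close>

definition lower_interval :: "'a::lattice set \<Rightarrow> 'a \<Rightarrow> 'a set" where
  "lower_interval L m = {z \<in> L. z \<le> m}"

definition upper_interval :: "'a::lattice set \<Rightarrow> 'a \<Rightarrow> 'a set" where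
  "upper_interval L j = {z \<in> L. j \<le> z}"

definition prime_pair :: "'a::lattice set \<Rightarrow> 'a \<Rightarrow> 'a \<Rightarrow> bool" where
  "prime_pair L j0 m0 \<longleftrightarrow>
     j0 \<in> L \<and> m0 \<in> L \<and>
     L = lower_interval L m0 \<union> upper_interval L j0 \<and>
     lower_interval L m0 \<inter> upper_interval L j0 = {}"

inductive compatibly_dismantlable :: "'a::lattice set \<Rightarrow> bool" where
  singleton: "compatibly_dismantlable L"
    if "uniquely_paired L" and "card L = 1"
| dismantle: "compatibly_dismantlable L"
    if "uniquely_paired L"
      and "prime_pair L j0 m0"
      and "compatibly_dismantlable (upper_interval L j0)"
      and "bij_betw (\<lambda>j. sup j0 j) {j \<in> join_irreds L. j0 \<le> kappa L j}
             (join_irreds (upper_interval L j0))"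
      and "\<forall>j \<in> {j \<in> join_irreds L. j0 \<le> kappa L j}.
             kappa (upper_interval L j0) (sup j0 j) = kappa L j"
      and "compatibly_dismantlable (lower_interval L m0)"
      and "bij_betw (\<lambda>m. inf m0 m) {m \<in> meet_irreds L. kappa_inv L m \<le> m0}
             (meet_irreds (lower_interval L m0))"
      and "\<forall>m \<in> {m \<in> meet_irreds L. kappa_inv L m \<le> m0}.
             kappa_inv (lower_interval L m0) (inf m0 m) = kappa_inv L m"

definition galois_edge :: "'a::lattice set \<Rightarrow> 'a \<Rightarrow> 'a \<Rightarrow> bool" where
  "galois_edge L j j' \<longleftrightarrow>
     j \<in> join_irreds L \<and> j' \<in> join_irreds L \<and> j \<noteq> j' \<and> \<not> j \<le> kappa L j'"

definition galois_independent :: "'a::lattice set \<Rightarrow> 'a set \<Rightarrow> bool" where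
  "galois_independent L A \<longleftrightarrow>
     A \<subseteq> join_irreds L \<and> (\<forall>j\<in>A. \<forall>j'\<in>A. \<not> galois_edge L j j')"

definition J_set :: "'a::lattice set \<Rightarrow> 'a \<Rightarrow> 'a set" where
  "J_set L x = {j \<in> join_irreds L. j \<le> x}"

definition M_set :: "'a::lattice set \<Rightarrow> 'a \<Rightarrow> 'a set" where
  "M_set L x = {j \<in> join_irreds L. x \<le> kappa L j}"

text \<open>
  The label $j_{xy}$ of a cover $x \lessdot y$; it is well defined when \<open>L\<close> is compatibly
  dismantlable, since \<open>M_set L x \<inter> J_set L y\<close> is then a singleton.
\<close>

definition cover_label :: "'a::lattice set \<Rightarrow> 'a \<Rightarrow> 'a \<Rightarrow> 'a" where
  "cover_label L x y = (THE j. j \<in> M_set L x \<inter> J_set L y)"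

definition down_labels :: "'a::lattice set \<Rightarrow> 'a \<Rightarrow> 'a set" where
  "down_labels L x = {cover_label L y x |y. covered_by L y x}"

definition up_labels :: "'a::lattice set \<Rightarrow> 'a \<Rightarrow> 'a set" where
  "up_labels L x = {cover_label L x y |y. covered_by L x y}"

definition semidistrim :: "'a::lattice set \<Rightarrow> bool" where
  "semidistrim L \<longleftrightarrow>
     compatibly_dismantlable L \<and>
     (\<forall>x\<in>L. galois_independent L (down_labels L x) \<and> galois_independent L (up_labels L x))"

end

theory Submission
  imports Defs "HOL-Library.Dual_Ordered_Lattice"
begin

text \<open>
  By duality it suffices to treat an upper interval $[u, \hat 1]$. Whenever $u \le \kappa_L(j)$,
  the element $u \vee j$ covers some element of $[u, \kappa_L(j)]$, so $j$ is a label of a cover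
  below $u \vee j$. Independence of the downward labels of $u \vee j$ then makes $u \vee j$
  join-irreducible in $[u, \hat 1]$, and $j \mapsto u \vee j$ is a bijection from
  $\{j : u \le \kappa_L(j)\}$ to $\mathcal{J}_{[u, \hat 1]}$ under which $\kappa_L$ becomes a
  pairing. That pairing is unique because any other one extends, by $\kappa_L$, to a
  pairing of $L$. If $(j_0, m_0)$ is a prime pair of $L$ and $u \le m_0$, then
  $(u \vee j_0, m_0)$ is one of $[u, \hat 1]$, so that compatible dismantlability follows by
  induction.
\<close>

section \<open>Pairings as bijections between linked pairs\<close>

text \<open>Write 0 and 1 for the bottom and the top. The pairing of [u,1] is not built along the
  dismantling: independence of labels yields it for every u at once, directly from
  \<open>kappa L\<close>. This matters because the induction compares three upper intervals, [u,1],
  [sup u j0,1] and [u,m0], the last one inside [0,m0]. The bijections that a dismantling of [u,1]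
  demands then come from known ones, through identities such as sup (sup u j0) (sup u j) = sup (sup
  u j0) j. Duality takes an argument of its own, since the definitions favour join-irreducibles:
  cover labels and the Galois graph live on them. Order reversal replaces \<open>kappa\<close> by
  its inverse, exchanges conditions (i) and (ii) and reverses the edges of the graph. The relation
  \<open>linked\<close>, which treats j and m alike, keeps this translation short.\<close>

definition linked :: "'a::lattice set \<Rightarrow> 'a \<Rightarrow> 'a \<Rightarrow> bool" where
  "linked L j m \<longleftrightarrow>
     \<not> j \<le> m \<and> (\<forall>z\<in>L. z < j \<longrightarrow> z \<le> m) \<and> (\<forall>z\<in>L. m < z \<longrightarrow> j \<le> z)"

lemma covered_by_above:
  assumes "finite_lattice_on L" "x \<in> L" "y \<in> L" "x < y"
  obtains z where "covered_by L x z" "z \<le> y"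
proof -
  have "finite {z \<in> L. x < z \<and> z \<le> y}" "y \<in> {z \<in> L. x < z \<and> z \<le> y}"
    using assms by (auto simp: finite_lattice_on_def)
  then obtain z where z: "z \<in> {z \<in> L. x < z \<and> z \<le> y}"
    and min: "\<And>w. w \<in> {z \<in> L. x < z \<and> z \<le> y} \<Longrightarrow> w \<le> z \<Longrightarrow> z = w"
    by (metis (no_types, lifting) finite_has_minimal2)
  have "covered_by L x z"
    unfolding covered_by_def using z min assms(2)
    by (smt (verit) less_le_not_le mem_Collect_eq order.strict_implies_order order_trans)
  with z that show thesis by blast
qed

lemma covered_by_below:
  assumes "finite_lattice_on L" "x \<in> L" "y \<in> L" "x < y"
  obtains z where "covered_by L z y" "x \<le> z"
proof -
  have "finite {z \<in> L. x \<le> z \<and> z < y}" "x \<in> {z \<in> L. x \<le> z \<and> z < y}"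
    using assms by (auto simp: finite_lattice_on_def)
  then obtain z where z: "z \<in> {z \<in> L. x \<le> z \<and> z < y}"
    and max: "\<And>w. w \<in> {z \<in> L. x \<le> z \<and> z < y} \<Longrightarrow> z \<le> w \<Longrightarrow> z = w"
    by (metis (no_types, lifting) finite_has_maximal2)
  have "covered_by L z y"
    unfolding covered_by_def using z max assms(3)
    by (smt (verit) less_le_not_le mem_Collect_eq order.strict_implies_order order_trans)
  with z that show thesis by blast
qed

lemma join_irredI:
  assumes "j \<in> L" "c \<in> L" "c < j" "\<And>z. z \<in> L \<Longrightarrow> z < j \<Longrightarrow> z \<le> c"
  shows "j \<in> join_irreds L" "lower_star L j = c"
proof -
  have "covered_by L x j \<longleftrightarrow> x = c" for x
    unfolding covered_by_def using assms
    by (metis leD order.not_eq_order_implies_strict)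
  then show "j \<in> join_irreds L" "lower_star L j = c"
    using assms by (auto simp: join_irreds_def lower_star_def)
qed

lemma meet_irredI:
  assumes "m \<in> L" "c \<in> L" "m < c" "\<And>z. z \<in> L \<Longrightarrow> m < z \<Longrightarrow> c \<le> z"
  shows "m \<in> meet_irreds L" "upper_star L m = c"
proof -
  have "covered_by L m x \<longleftrightarrow> x = c" for x
    unfolding covered_by_def using assms
    by (metis leD order.not_eq_order_implies_strict)
  then show "m \<in> meet_irreds L" "upper_star L m = c"
    using assms by (auto simp: meet_irreds_def upper_star_def)
qed

lemma join_irredE:
  assumes "finite_lattice_on L" "j \<in> join_irreds L"
  obtains c where "j \<in> L" "c \<in> L" "c < j" "\<And>z. z \<in> L \<Longrightarrow> z < j \<Longrightarrow> z \<le> c"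
    "lower_star L j = c"
proof -
  from assms(2) obtain c where j: "j \<in> L" and c: "covered_by L c j"
    and u: "\<And>x. covered_by L x j \<Longrightarrow> x = c"
    by (auto simp: join_irreds_def)
  have "z \<le> c" if "z \<in> L" "z < j" for z
    using covered_by_below[OF assms(1) that(1) j that(2)] u by metis
  moreover have "c \<in> L" "c < j" using c by (auto simp: covered_by_def)
  ultimately show thesis using that j join_irredI(2) by metis
qed

lemma meet_irredE:
  assumes "finite_lattice_on L" "m \<in> meet_irreds L"
  obtains c where "m \<in> L" "c \<in> L" "m < c" "\<And>z. z \<in> L \<Longrightarrow> m < z \<Longrightarrow> c \<le> z"
    "upper_star L m = c"
proof -
  from assms(2) obtain c where m: "m \<in> L" and c: "covered_by L m c"
    and u: "\<And>x. covered_by L m x \<Longrightarrow> x = c"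
    by (auto simp: meet_irreds_def)
  have "c \<le> z" if "z \<in> L" "m < z" for z
    using covered_by_above[OF assms(1) m that(1) that(2)] u by metis
  moreover have "c \<in> L" "m < c" using c by (auto simp: covered_by_def)
  ultimately show thesis using that m meet_irredI(2) by metis
qed

text \<open>\<open>inf j m\<close> bounds everything strictly below \<open>j\<close>, and
  \<open>sup j m\<close> is a bound for everything strictly above \<open>m\<close>. This is how
  \<open>sup u j\<close> is later recognised as join-irreducible in [u,1].\<close>

lemma linked_irreds:
  assumes "finite_lattice_on L" "j \<in> L" "m \<in> L" "linked L j m"
  shows "j \<in> join_irreds L" "m \<in> meet_irreds L"
proof -
  have c: "inf j m \<in> L" "sup j m \<in> L"
    using assms by (auto simp: finite_lattice_on_def)
  have "inf j m < j" "m < sup j m"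
    using assms(4) by (auto simp: linked_def less_le_not_le)
  with c show "j \<in> join_irreds L" "m \<in> meet_irreds L"
    using assms(4) join_irredI(1)[OF assms(2), of "inf j m"]
      meet_irredI(1)[OF assms(3), of "sup j m"]
    by (auto simp: linked_def less_imp_le)
qed

text \<open>The equations for the two stars translate into \<open>linked\<close>. Conversely
  \<open>linked\<close> makes \<open>m\<close> maximal, because anything strictly above
  \<open>m\<close> lies above \<open>j\<close> and so meets \<open>j\<close> in \<open>j\<close>
  itself; minimality of \<open>j\<close> is dual. The result mentions neither covers nor inverse
  functions.\<close>

lemma partners_iff_linked:
  assumes L: "finite_lattice_on L" and "j \<in> join_irreds L" "m \<in> meet_irreds L"
  shows "m \<in> meet_partners L j \<and> j \<in> join_partners L m \<longleftrightarrow> linked L j m"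
proof -
  from assms(2) obtain c where j: "j \<in> L" "c \<in> L" "c < j"
    "\<And>z. z \<in> L \<Longrightarrow> z < j \<Longrightarrow> z \<le> c" "lower_star L j = c"
    using join_irredE[OF L] by metis
  from assms(3) obtain d where m: "m \<in> L" "d \<in> L" "m < d"
    "\<And>z. z \<in> L \<Longrightarrow> m < z \<Longrightarrow> d \<le> z" "upper_star L m = d"
    using meet_irredE[OF L] by metis
  show ?thesis
  proof
    assume h: "m \<in> meet_partners L j \<and> j \<in> join_partners L m"
    then have "inf j m = c" "sup m j = d"
      using j m by (auto simp: meet_partners_def join_partners_def maximal_elems_def minimal_elems_def)
    then have "\<not> j \<le> m" "c \<le> m" "j \<le> d"
      using j(3) by (auto simp: inf.absorb1)
    then show "linked L j m"
      unfolding linked_def using j m by (meson order_trans)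
  next
    assume l: "linked L j m"
    have "inf j m = c"
      using l j m unfolding linked_def
      by (metis L finite_lattice_on_def inf.cobounded1 inf.cobounded2 inf_greatest
          order.antisym order.not_eq_order_implies_strict order.strict_implies_order)
    moreover have "sup m j = d"
      using l j m unfolding linked_def
      by (metis L finite_lattice_on_def sup.cobounded1 sup.cobounded2 sup_least
          order.antisym order.not_eq_order_implies_strict order.strict_implies_order)
    moreover have "inf j y \<noteq> c" if "y \<in> L" "m < y" for y
      using l that j unfolding linked_def by (metis inf.absorb1 order_less_irrefl)
    moreover have "sup m y \<noteq> d" if "y \<in> L" "y < j" for y
      using l that m unfolding linked_def by (metis sup.absorb1 order_less_irrefl)
    ultimately show "m \<in> meet_partners L j \<and> j \<in> join_partners L m"
      using j m unfolding meet_partners_def join_partners_def maximal_elems_def minimal_elems_def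
      by auto blast+
  qed
qed

lemma pairing_iff_linked:
  assumes "finite_lattice_on L"
  shows "pairing L \<kappa> \<longleftrightarrow> \<kappa> \<in> extensional (join_irreds L) \<and>
     bij_betw \<kappa> (join_irreds L) (meet_irreds L) \<and> (\<forall>j\<in>join_irreds L. linked L j (\<kappa> j))"
proof -
  have "(\<forall>m\<in>meet_irreds L. inv_into (join_irreds L) \<kappa> m \<in> join_partners L m) \<longleftrightarrow>
      (\<forall>j\<in>join_irreds L. j \<in> join_partners L (\<kappa> j))"
    if b: "bij_betw \<kappa> (join_irreds L) (meet_irreds L)"
  proof -
    from b have "inj_on \<kappa> (join_irreds L)" "meet_irreds L = \<kappa> ` join_irreds L"
      by (auto simp: bij_betw_def)
    then show ?thesis by simp
  qed
  moreover have "\<kappa> j \<in> meet_partners L j \<and> j \<in> join_partners L (\<kappa> j) \<longleftrightarrow> linked L j (\<kappa> j)"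
    if "bij_betw \<kappa> (join_irreds L) (meet_irreds L)" "j \<in> join_irreds L" for j
    using partners_iff_linked[OF assms that(2)] bij_betw_apply[OF that] by blast
  ultimately show ?thesis
    unfolding pairing_def by blast
qed

lemma uniquely_pairedI:
  assumes L: "finite_lattice_on L" and "bij_betw f (join_irreds L) (meet_irreds L)"
    and "\<And>j. j \<in> join_irreds L \<Longrightarrow> linked L j (f j)"
    and u: "\<And>g j. bij_betw g (join_irreds L) (meet_irreds L) \<Longrightarrow>
      (\<And>j. j \<in> join_irreds L \<Longrightarrow> linked L j (g j)) \<Longrightarrow> j \<in> join_irreds L \<Longrightarrow> g j = f j"
  shows "uniquely_paired L" "\<And>j. j \<in> join_irreds L \<Longrightarrow> kappa L j = f j"
proof -
  let ?f = "restrict f (join_irreds L)"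
  have p: "pairing L ?f"
    unfolding pairing_iff_linked[OF L] using assms(2,3) by (auto cong: bij_betw_cong)
  have "g = ?f" if "pairing L g" for g
    using that u[of g] unfolding pairing_iff_linked[OF L]
    by (intro extensionalityI[of _ "join_irreds L"]) auto
  with p have ex: "\<exists>!g. pairing L g" by (rule ex1I)
  then show "uniquely_paired L" using L by (simp add: uniquely_paired_def)
  have "kappa L = ?f" unfolding kappa_def by (rule the1_equality[of "pairing L", OF ex p])
  then show "\<And>j. j \<in> join_irreds L \<Longrightarrow> kappa L j = f j" by simp
qed

lemma uniquely_paired_kappa:
  assumes "uniquely_paired L"
  shows "bij_betw (kappa L) (join_irreds L) (meet_irreds L)"
    and "j \<in> join_irreds L \<Longrightarrow> linked L j (kappa L j)"
proof -
  have "finite_lattice_on L" "pairing L (kappa L)"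
    using assms theI'[of "pairing L"] unfolding uniquely_paired_def kappa_def by simp_all
  then show "bij_betw (kappa L) (join_irreds L) (meet_irreds L)"
    "j \<in> join_irreds L \<Longrightarrow> linked L j (kappa L j)"
    by (auto simp: pairing_iff_linked)
qed

lemma uniquely_paired_kappa_unique:
  assumes "uniquely_paired L" "bij_betw f (join_irreds L) (meet_irreds L)"
    and "\<And>j. j \<in> join_irreds L \<Longrightarrow> linked L j (f j)" and "j \<in> join_irreds L"
  shows "f j = kappa L j"
proof -
  have L: "finite_lattice_on L" using assms(1) by (simp add: uniquely_paired_def)
  have "pairing L (restrict f (join_irreds L))"
    unfolding pairing_iff_linked[OF L] using assms(2,3) by (auto cong: bij_betw_cong)
  then have "kappa L = restrict f (join_irreds L)"
    using assms(1) unfolding kappa_def uniquely_paired_def by (blast intro: the1_equality)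
  then show ?thesis using assms(4) by simp
qed

lemma kappa_inv_props:
  assumes "uniquely_paired L"
  shows "m \<in> meet_irreds L \<Longrightarrow> kappa_inv L m \<in> join_irreds L"
    and "m \<in> meet_irreds L \<Longrightarrow> kappa L (kappa_inv L m) = m"
    and "j \<in> join_irreds L \<Longrightarrow> kappa_inv L (kappa L j) = j"
    and "j \<in> join_irreds L \<Longrightarrow> kappa L j \<in> meet_irreds L"
  using uniquely_paired_kappa(1)[OF assms] unfolding kappa_inv_def
  by (meson bij_betw_apply bij_betw_inv_into bij_betw_inv_into_left bij_betw_inv_into_right)+

lemma irreds_subset: "join_irreds L \<subseteq> L" "meet_irreds L \<subseteq> L"
  by (auto simp: join_irreds_def meet_irreds_def)

section \<open>Prime pairs\<close>

lemma prime_pair_linked: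
  assumes "prime_pair L j0 m0"
  shows "linked L j0 m0" "j0 \<in> L" "m0 \<in> L" "\<not> j0 \<le> m0"
    "z \<in> L \<Longrightarrow> z \<le> m0 \<or> j0 \<le> z" "z \<le> m0 \<Longrightarrow> \<not> j0 \<le> z"
proof -
  show *: "j0 \<in> L" "m0 \<in> L" "\<not> j0 \<le> m0" and **: "\<And>z. z \<in> L \<Longrightarrow> z \<le> m0 \<or> j0 \<le> z"
    using assms unfolding prime_pair_def lower_interval_def upper_interval_def by blast+
  then show "linked L j0 m0" unfolding linked_def by (meson leD)
  show "z \<le> m0 \<Longrightarrow> \<not> j0 \<le> z" using * order_trans by blast
qed

text \<open>\<open>kappa L j0\<close> is not above \<open>j0\<close>, so it lies below
  \<open>m0\<close>; were it strictly below, linkedness would put \<open>j0\<close> below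
  \<open>m0\<close>.\<close>

lemma prime_pair_kappa:
  assumes "uniquely_paired L" "prime_pair L j0 m0"
  shows "j0 \<in> join_irreds L" "kappa L j0 = m0"
proof -
  have L: "finite_lattice_on L" using assms(1) by (simp add: uniquely_paired_def)
  note p = prime_pair_linked[OF assms(2)]
  show j: "j0 \<in> join_irreds L" using linked_irreds(1)[OF L] p by blast
  have l: "linked L j0 (kappa L j0)" and "kappa L j0 \<in> L"
    using uniquely_paired_kappa(2)[OF assms(1) j] kappa_inv_props(4)[OF assms(1) j]
      irreds_subset by blast+
  then show "kappa L j0 = m0"
    using p unfolding linked_def by (metis order.not_eq_order_implies_strict)
qed

lemma prime_pair_kappa_above:
  assumes "uniquely_paired L" "prime_pair L j0 m0" "j \<in> join_irreds L" "j0 < j"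
  shows "j0 \<le> kappa L j"
  using uniquely_paired_kappa(2)[OF assms(1,3)] prime_pair_linked(2)[OF assms(2)] assms(4)
  by (simp add: linked_def)

lemma kappa_not_ge:
  assumes "uniquely_paired L" "j \<in> join_irreds L"
  shows "\<not> j \<le> kappa L j"
  using uniquely_paired_kappa(2)[OF assms] by (simp add: linked_def)

section \<open>Intervals\<close>

lemma finite_lattice_on_intervals:
  assumes "finite_lattice_on L" "u \<in> L"
  shows "finite_lattice_on (upper_interval L u)" "finite_lattice_on (lower_interval L u)"
  using assms unfolding finite_lattice_on_def upper_interval_def lower_interval_def
  by (auto simp: le_supI1 le_infI1)

lemma covered_by_upper_interval:
  "covered_by (upper_interval L u) x y \<longleftrightarrow> covered_by L x y \<and> u \<le> x"
  unfolding covered_by_def upper_interval_def by (auto dest: order.strict_trans1 intro: order_trans less_imp_le)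

lemma covered_by_lower_interval:
  "covered_by (lower_interval L v) x y \<longleftrightarrow> covered_by L x y \<and> y \<le> v"
  unfolding covered_by_def lower_interval_def by (auto dest: order.strict_trans2 intro: order_trans less_imp_le)

text \<open>Upper covers of elements of [u,1] stay in [u,1], so meet-irreducibles are inherited.
  Lower covers may be lost, which is why the join-irreducibles have to be described by j -> sup u
  j.\<close>

lemma meet_irreds_upper_interval:
  "meet_irreds (upper_interval L u) = {m \<in> meet_irreds L. u \<le> m}"
  unfolding meet_irreds_def covered_by_upper_interval by (auto simp: upper_interval_def)

lemma join_irreds_lower_interval:
  "join_irreds (lower_interval L v) = {j \<in> join_irreds L. j \<le> v}"
  unfolding join_irreds_def covered_by_lower_interval by (auto simp: lower_interval_def)

text \<open>Condition (ii) speaks of inverse pairings. As the join-irreducibles of [0,v] are those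
  of \<open>L\<close> below \<open>v\<close>, inverting it gives a formula for \<open>kappa\<close>
  itself, the form in which labels are compared.\<close>

lemma lower_interval_kappa:
  assumes "uniquely_paired L" "uniquely_paired (lower_interval L v)"
    and b: "bij_betw (\<lambda>m. inf v m) {m \<in> meet_irreds L. kappa_inv L m \<le> v}
             (meet_irreds (lower_interval L v))"
    and k: "\<forall>m \<in> {m \<in> meet_irreds L. kappa_inv L m \<le> v}.
             kappa_inv (lower_interval L v) (inf v m) = kappa_inv L m"
    and j: "j \<in> join_irreds L" "j \<le> v"
  shows "kappa (lower_interval L v) j = inf v (kappa L j)"
proof -
  have *: "kappa L j \<in> {m \<in> meet_irreds L. kappa_inv L m \<le> v}"
    using kappa_inv_props[OF assms(1)] j by auto
  then have "kappa_inv (lower_interval L v) (inf v (kappa L j)) = j"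
    using k kappa_inv_props(3)[OF assms(1)] j by auto
  then show ?thesis
    using kappa_inv_props(2)[OF assms(2)] bij_betw_apply[OF b *] by metis
qed

section \<open>Cover labels\<close>

lemma compatibly_dismantlable_imp_uniquely_paired:
  "compatibly_dismantlable L \<Longrightarrow> uniquely_paired L"
  by (auto elim: compatibly_dismantlable.cases)

lemma bij_betw_imp_ex1:
  assumes "bij_betw f A B" "\<exists>!b. b \<in> B \<and> P b"
  shows "\<exists>!a. a \<in> A \<and> P (f a)"
proof -
  from assms obtain a where a: "a \<in> A" "P (f a)" and u: "\<And>b. b \<in> B \<Longrightarrow> P b \<Longrightarrow> b = f a"
    by (auto simp: bij_betw_def)
  have "c = a" if "c \<in> A" "P (f c)" for c
    using u[of "f c"] that a assms(1) by (auto simp: bij_betw_def dest: inj_onD)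
  with a show ?thesis by blast
qed

text \<open>Induction along the dismantling. A cover lies in [j0,1], lies in [0,m0], or crosses from
  the latter to the former. The first two kinds inherit their label through conditions (i) and (ii);
  a crossing cover is labelled by \<open>j0\<close>.\<close>

lemma cover_label_unique:
  assumes "compatibly_dismantlable L" "covered_by L x y"
  shows "\<exists>!j. j \<in> join_irreds L \<and> x \<le> kappa L j \<and> j \<le> y"
  using assms
proof (induction arbitrary: x y rule: compatibly_dismantlable.induct)
  case (singleton L)
  then have "x = y" unfolding covered_by_def by (metis card_1_singletonE singletonD)
  then show ?case using singleton by (simp add: covered_by_def)
next
  case (dismantle L j0 m0)
  note up = dismantle.hyps(1) and pp = dismantle.hyps(2)
  note p = prime_pair_linked[OF pp] prime_pair_kappa[OF up pp]
  have xy: "x \<in> L" "y \<in> L" "x < y" using dismantle.prems by (auto simp: covered_by_def)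
  consider "j0 \<le> x" | "y \<le> m0" | "x \<le> m0" "j0 \<le> y" using p(5) xy by blast
  then show ?case
  proof cases
    case 1
    let ?A = "{j \<in> join_irreds L. j0 \<le> kappa L j}"
    have "covered_by (upper_interval L j0) x y"
      using 1 dismantle.prems by (simp add: covered_by_upper_interval)
    from dismantle.IH(1)[OF this]
    have "\<exists>!j. j \<in> ?A \<and> x \<le> kappa (upper_interval L j0) (sup j0 j) \<and> sup j0 j \<le> y"
      by (rule bij_betw_imp_ex1[OF dismantle.hyps(4)])
    moreover have "(j \<in> ?A \<and> x \<le> kappa (upper_interval L j0) (sup j0 j) \<and> sup j0 j \<le> y) \<longleftrightarrow>
       j \<in> join_irreds L \<and> x \<le> kappa L j \<and> j \<le> y" for j
    proof -
      have "j0 \<le> y" using 1 xy by simp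
      moreover have "x \<le> kappa L j \<Longrightarrow> j0 \<le> kappa L j" using 1 by simp
      moreover have "j \<in> ?A \<Longrightarrow> kappa (upper_interval L j0) (sup j0 j) = kappa L j"
        using dismantle.hyps(5) by blast
      ultimately show ?thesis by auto
    qed
    ultimately show ?thesis by simp
  next
    case 2
    have "covered_by (lower_interval L m0) x y"
      using 2 dismantle.prems by (simp add: covered_by_lower_interval)
    from dismantle.IH(2)[OF this]
    have "\<exists>!j. j \<in> join_irreds L \<and> j \<le> m0 \<and> x \<le> kappa (lower_interval L m0) j \<and> j \<le> y"
      by (simp add: join_irreds_lower_interval conj_assoc)
    moreover have "(j \<in> join_irreds L \<and> j \<le> m0 \<and> x \<le> kappa (lower_interval L m0) j \<and> j \<le> y) \<longleftrightarrow>
       j \<in> join_irreds L \<and> x \<le> kappa L j \<and> j \<le> y" for j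
    proof -
      have "x \<le> m0" "j \<le> y \<Longrightarrow> j \<le> m0" using 2 xy by simp_all
      then show ?thesis
        using lower_interval_kappa[OF up _ dismantle.hyps(7,8), of j]
          compatibly_dismantlable_imp_uniquely_paired[OF dismantle.hyps(6)] by auto
    qed
    ultimately show ?thesis by simp
  next
    case 3
    \<comment> \<open>A crossing cover has x = inf y m0 and y = sup x j0. Another label
      \<open>j\<close> is either below \<open>m0\<close>, hence below x, or strictly above
      \<open>j0\<close>, and then \<open>kappa L j\<close> is above \<open>j0\<close> and so above
      y. Either way j <= kappa L j.\<close>
    have "j = j0" if j: "j \<in> join_irreds L" "x \<le> kappa L j" "j \<le> y" for j
    proof (rule ccontr)
      assume ne: "j \<noteq> j0"
      have L: "j \<in> L" "finite_lattice_on L"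
        using j irreds_subset up by (auto simp: uniquely_paired_def)
      have x: "inf y m0 = x"
      proof -
        have "inf y m0 \<in> L" using L xy p(3) by (simp add: finite_lattice_on_def)
        moreover have "x \<le> inf y m0" using 3 xy by simp
        moreover have "inf y m0 \<noteq> y" using p(6)[of y] 3 by (auto simp: inf.absorb_iff1)
        then have "inf y m0 < y" by (simp add: less_le)
        ultimately show ?thesis using dismantle.prems unfolding covered_by_def less_le by metis
      qed
      have y: "sup x j0 = y"
      proof -
        have "sup x j0 \<in> L" using L xy p(2) by (simp add: finite_lattice_on_def)
        moreover have "sup x j0 \<le> y" using 3 xy by simp
        moreover have "sup x j0 \<noteq> x" using p(6)[of x] 3 by (auto simp: sup.absorb_iff1)
        then have "x < sup x j0" by (simp add: less_le)
        ultimately show ?thesis using dismantle.prems unfolding covered_by_def less_le by metis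
      qed
      show False
      proof (cases "j \<le> m0")
        case True
        with j x have "j \<le> kappa L j" by (metis le_inf_iff order_trans)
        then show False using kappa_not_ge[OF up j(1)] by simp
      next
        case False
        then have "j0 < j" using p(5) L ne by (auto simp: less_le)
        then have "j0 \<le> kappa L j" using prime_pair_kappa_above[OF up pp j(1)] by simp
        with j y have "j \<le> kappa L j" by (metis le_sup_iff order_trans)
        then show False using kappa_not_ge[OF up j(1)] by simp
      qed
    qed
    moreover have "j0 \<in> join_irreds L \<and> x \<le> kappa L j0 \<and> j0 \<le> y" using p(7,8) 3 by simp
    ultimately show ?thesis by blast
  qed
qed

text \<open>The cover found here necessarily has label \<open>j\<close>, which is how the lemma is
  used. The two blocks of the dismantling are settled by induction; what remains is \<open>u\<close>
  below \<open>m0\<close> with \<open>j\<close> above \<open>j0\<close>.\<close>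

lemma cover_with_label:
  assumes "compatibly_dismantlable L" "u \<in> L" "j \<in> join_irreds L" "u \<le> kappa L j"
  shows "\<exists>z. covered_by L z (sup u j) \<and> u \<le> z \<and> z \<le> kappa L j"
  using assms
proof (induction arbitrary: u j rule: compatibly_dismantlable.induct)
  case (singleton L)
  then have "kappa L j = j"
    using kappa_inv_props(4)[OF singleton(1), of j] irreds_subset
    by (metis card_1_singletonE singletonD subsetD)
  then show ?case using kappa_not_ge[OF singleton(1), of j] singleton by simp
next
  case (dismantle L j0 m0)
  note up = dismantle.hyps(1) and pp = dismantle.hyps(2)
  note p = prime_pair_linked[OF pp] prime_pair_kappa[OF up pp]
  have L: "finite_lattice_on L" using up by (simp add: uniquely_paired_def)
  have jL: "j \<in> L" if "j \<in> join_irreds L" for j using that irreds_subset by blast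
  \<comment> \<open>Condition (i) replaces \<open>j\<close> by \<open>sup j0 j\<close>, with the
    same value of the pairing and the same join with \<open>u\<close>. It is stated for all
    \<open>u\<close> and \<open>j\<close> because it is used again for
    \<open>sup u j0\<close>.\<close>
  have above: "\<exists>z. covered_by L z (sup u j) \<and> u \<le> z \<and> z \<le> kappa L j"
    if u: "u \<in> L" "j0 \<le> u" "j \<in> join_irreds L" "u \<le> kappa L j" for u j
  proof -
    have A: "j \<in> {j \<in> join_irreds L. j0 \<le> kappa L j}" using u by (auto intro: order_trans)
    have "sup j0 j \<in> join_irreds (upper_interval L j0)"
      using bij_betw_apply[OF dismantle.hyps(4) A] by simp
    moreover have "kappa (upper_interval L j0) (sup j0 j) = kappa L j"
      using dismantle.hyps(5) A by blast
    moreover have "sup u (sup j0 j) = sup u j" using u by (simp add: sup.absorb1 sup.assoc[symmetric])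
    moreover have "u \<in> upper_interval L j0" using u by (simp add: upper_interval_def)
    ultimately show ?thesis
      using dismantle.IH(1)[of u "sup j0 j"] u by (auto simp: covered_by_upper_interval)
  qed
  show ?case
  proof (cases "j0 \<le> u")
    case True
    then show ?thesis using above dismantle.prems by blast
  next
    case False
    then have um: "u \<le> m0" using p(5) dismantle.prems by blast
    consider "j \<le> m0" | "j = j0" | "j0 < j" using p(5) jL dismantle.prems by (metis less_le)
    then show ?thesis
    proof cases
      case 1
      have "kappa (lower_interval L m0) j = inf m0 (kappa L j)"
        using lower_interval_kappa[OF up _ dismantle.hyps(7,8), of j]
          compatibly_dismantlable_imp_uniquely_paired[OF dismantle.hyps(6)] 1 dismantle.prems by blast
      moreover have "u \<in> lower_interval L m0"
        using um dismantle.prems by (simp add: lower_interval_def)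
      ultimately show ?thesis
        using dismantle.IH(2)[of u j] um 1 dismantle.prems
        by (auto simp: covered_by_lower_interval join_irreds_lower_interval)
    next
      case 2
      \<comment> \<open>The witness is \<open>inf (sup u j0) m0\<close>: anything strictly between
        it and \<open>sup u j0\<close> is not below \<open>m0\<close>, so it is above
        \<open>j0\<close> as well as \<open>u\<close>.\<close>
      have w: "sup u j0 \<in> L" "inf (sup u j0) m0 \<in> L"
        using L p(2,3) dismantle.prems unfolding finite_lattice_on_def by blast+
      have "sup u j0 \<le> z" if z: "z \<in> L" "inf (sup u j0) m0 < z" "z < sup u j0" for z
      proof -
        have "\<not> z \<le> m0" using z by (metis inf_greatest leD less_imp_le)
        moreover have "u \<le> z" using um z by (metis inf_greatest less_imp_le order_trans sup_ge1)
        ultimately show ?thesis using p(5) z by auto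
      qed
      moreover have "inf (sup u j0) m0 < sup u j0"
        using p(4,6) by (metis inf.cobounded1 inf.cobounded2 order.not_eq_order_implies_strict sup_ge2)
      ultimately have "covered_by L (inf (sup u j0) m0) (sup u j0)"
        unfolding covered_by_def using w by (meson leD)
      then show ?thesis using 2 um p(8) by auto
    next
      case 3
      \<comment> \<open>Raising \<open>u\<close> to \<open>sup u j0\<close> keeps it below
        \<open>kappa L j\<close> and does not change its join with \<open>j\<close>.\<close>
      have "j0 \<le> kappa L j" using prime_pair_kappa_above[OF up pp] dismantle.prems 3 by simp
      moreover have "sup u j0 \<in> L" using L p(2) dismantle.prems unfolding finite_lattice_on_def by blast
      moreover have "sup (sup u j0) j = sup u j" using 3 by (simp add: sup.assoc sup.absorb2 less_imp_le)
      ultimately show ?thesis using above[of "sup u j0" j] dismantle.prems by auto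
    qed
  qed
qed


section \<open>Semidistrim lattices in terms of labelled covers\<close>

text \<open>The relational form of j = j_xy, which passes between lattices without handling a
  definite description.\<close>

definition labelled_cover :: "'a::lattice set \<Rightarrow> 'a \<Rightarrow> 'a \<Rightarrow> 'a \<Rightarrow> bool" where
  "labelled_cover L x y j \<longleftrightarrow>
     covered_by L x y \<and> j \<in> join_irreds L \<and> x \<le> kappa L j \<and> j \<le> y"

lemma labels_eq:
  assumes "compatibly_dismantlable L"
  shows "down_labels L x = {j. \<exists>y. labelled_cover L y x j}"
    and "up_labels L x = {j. \<exists>y. labelled_cover L x y j}"
proof -
  have *: "covered_by L x y \<and> cover_label L x y = j \<longleftrightarrow> labelled_cover L x y j" for x y j
  proof (cases "covered_by L x y")
    case True
    let ?P = "\<lambda>j. j \<in> M_set L x \<inter> J_set L y"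
    have "\<exists>!j. ?P j"
      using cover_label_unique[OF assms True] by (simp add: M_set_def J_set_def conj_ac)
    then have "cover_label L x y = j \<longleftrightarrow> ?P j"
      unfolding cover_label_def using the1_equality[of ?P j] theI'[of ?P] by blast
    then show ?thesis using True by (auto simp: labelled_cover_def M_set_def J_set_def)
  qed (simp add: labelled_cover_def)
  show "down_labels L x = {j. \<exists>y. labelled_cover L y x j}"
    "up_labels L x = {j. \<exists>y. labelled_cover L x y j}"
    unfolding down_labels_def up_labels_def *[symmetric] by blast+
qed

lemma semidistrim_iff:
  "semidistrim L \<longleftrightarrow> compatibly_dismantlable L \<and>
     (\<forall>x y y' j j'. labelled_cover L y x j \<longrightarrow> labelled_cover L y' x j' \<longrightarrow> j \<noteq> j' \<longrightarrow> j \<le> kappa L j') \<and>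
     (\<forall>x y y' j j'. labelled_cover L x y j \<longrightarrow> labelled_cover L x y' j' \<longrightarrow> j \<noteq> j' \<longrightarrow> j \<le> kappa L j')"
proof (cases "compatibly_dismantlable L")
  case True
  have mem: "x \<in> L" "y \<in> L" "j \<in> join_irreds L" if "labelled_cover L x y j" for x y j
    using that by (auto simp: labelled_cover_def covered_by_def)
  have ind: "galois_independent L {j. \<exists>y. P y j} \<longleftrightarrow>
      (\<forall>y y' j j'. P y j \<longrightarrow> P y' j' \<longrightarrow> j \<noteq> j' \<longrightarrow> j \<le> kappa L j')"
    if "\<And>y j. P y j \<Longrightarrow> j \<in> join_irreds L" for P
    using that unfolding galois_independent_def galois_edge_def by (safe; blast)
  have down: "galois_independent L (down_labels L x) \<longleftrightarrow> (\<forall>y y' j j'.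
      labelled_cover L y x j \<longrightarrow> labelled_cover L y' x j' \<longrightarrow> j \<noteq> j' \<longrightarrow> j \<le> kappa L j')" for x
    unfolding labels_eq[OF True] by (rule ind) (rule mem)
  have up: "galois_independent L (up_labels L x) \<longleftrightarrow> (\<forall>y y' j j'.
      labelled_cover L x y j \<longrightarrow> labelled_cover L x y' j' \<longrightarrow> j \<noteq> j' \<longrightarrow> j \<le> kappa L j')" for x
    unfolding labels_eq[OF True] by (rule ind) (rule mem)
  show ?thesis
    unfolding semidistrim_def down up using True mem(1,2) by meson
qed (simp add: semidistrim_def)

lemma semidistrimD:
  assumes "semidistrim L"
  shows "labelled_cover L y x j \<Longrightarrow> labelled_cover L y' x j' \<Longrightarrow> j \<noteq> j' \<Longrightarrow> j \<le> kappa L j'"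
    and "labelled_cover L x y j \<Longrightarrow> labelled_cover L x y' j' \<Longrightarrow> j \<noteq> j' \<Longrightarrow> j \<le> kappa L j'"
  using assms unfolding semidistrim_iff by blast+

text \<open>Labels of covers in [u,1] are the joins of \<open>u\<close> with their labels in
  \<open>L\<close>, and j <= kappa L j' gives sup u j <= kappa L j' because u <= kappa L j'. Applied
  to \<open>j0\<close>, where the hypotheses are condition (i), and to a general \<open>u\<close>
  once [u,1] has been dismantled.\<close>

lemma semidistrim_upper_intervalI:
  assumes "semidistrim L" "compatibly_dismantlable (upper_interval L u)"
    and b: "bij_betw (\<lambda>j. sup u j) {j \<in> join_irreds L. u \<le> kappa L j}
      (join_irreds (upper_interval L u))"
    and k: "\<forall>j \<in> {j \<in> join_irreds L. u \<le> kappa L j}.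
      kappa (upper_interval L u) (sup u j) = kappa L j"
  shows "semidistrim (upper_interval L u)"
proof -
  have lab: "\<exists>j. w = sup u j \<and> u \<le> kappa L j \<and> labelled_cover L x y j \<and>
      kappa (upper_interval L u) w = kappa L j"
    if w: "labelled_cover (upper_interval L u) x y w" for x y w
  proof -
    from w b obtain j where "j \<in> {j \<in> join_irreds L. u \<le> kappa L j}" "w = sup u j"
      unfolding labelled_cover_def bij_betw_def by blast
    with w k show ?thesis
      by (auto simp: labelled_cover_def covered_by_upper_interval)
  qed
  show ?thesis
    unfolding semidistrim_iff
  proof (intro conjI allI impI)
    fix x y y' w w'
    assume w: "labelled_cover (upper_interval L u) y x w"
      "labelled_cover (upper_interval L u) y' x w'" "w \<noteq> w'"
    from lab[OF w(1)] obtain j where j: "w = sup u j" "labelled_cover L y x j" by blast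
    from lab[OF w(2)] obtain j' where j': "w' = sup u j'" "u \<le> kappa L j'"
      "labelled_cover L y' x j'" "kappa (upper_interval L u) w' = kappa L j'" by blast
    have "j \<le> kappa L j'" using semidistrimD(1)[OF assms(1) j(2) j'(3)] j(1) j'(1) w(3) by blast
    then show "w \<le> kappa (upper_interval L u) w'" using j(1) j'(2,4) by simp
  next
    fix x y y' w w'
    assume w: "labelled_cover (upper_interval L u) x y w"
      "labelled_cover (upper_interval L u) x y' w'" "w \<noteq> w'"
    from lab[OF w(1)] obtain j where j: "w = sup u j" "labelled_cover L x y j" by blast
    from lab[OF w(2)] obtain j' where j': "w' = sup u j'" "u \<le> kappa L j'"
      "labelled_cover L x y' j'" "kappa (upper_interval L u) w' = kappa L j'" by blast
    have "j \<le> kappa L j'" using semidistrimD(2)[OF assms(1) j(2) j'(3)] j(1) j'(1) w(3) by blast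
    then show "w \<le> kappa (upper_interval L u) w'" using j(1) j'(2,4) by simp
  qed (fact assms(2))
qed

text \<open>Covers keep their labels, and these lie below \<open>v\<close>, so meeting the values of
  the pairing with \<open>v\<close> preserves the inequalities.\<close>

lemma semidistrim_lower_intervalI:
  assumes "semidistrim L" "compatibly_dismantlable (lower_interval L v)"
    and k: "\<And>j. j \<in> join_irreds L \<Longrightarrow> j \<le> v \<Longrightarrow>
      kappa (lower_interval L v) j = inf v (kappa L j)"
  shows "semidistrim (lower_interval L v)"
proof -
  have lab: "labelled_cover L x y j \<and> j \<le> v \<and> kappa (lower_interval L v) j = inf v (kappa L j)"
    if "labelled_cover (lower_interval L v) x y j" for x y j
    using that k by (auto simp: labelled_cover_def covered_by_lower_interval join_irreds_lower_interval)
  show ?thesis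
    unfolding semidistrim_iff
  proof (intro conjI allI impI)
    fix x y y' w w'
    assume w: "labelled_cover (lower_interval L v) y x w"
      "labelled_cover (lower_interval L v) y' x w'" "w \<noteq> w'"
    show "w \<le> kappa (lower_interval L v) w'"
      using lab[OF w(1)] lab[OF w(2)] semidistrimD(1)[OF assms(1) _ _ w(3)] by auto
  next
    fix x y y' w w'
    assume w: "labelled_cover (lower_interval L v) x y w"
      "labelled_cover (lower_interval L v) x y' w'" "w \<noteq> w'"
    show "w \<le> kappa (lower_interval L v) w'"
      using lab[OF w(1)] lab[OF w(2)] semidistrimD(2)[OF assms(1) _ _ w(3)] by auto
  qed (fact assms(2))
qed

section \<open>Upper intervals of semidistrim lattices\<close>

lemma semidistrim_upper_interval_pairing:
  assumes sd: "semidistrim L" and u: "u \<in> L"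
  defines "A \<equiv> {j \<in> join_irreds L. u \<le> kappa L j}"
  shows "uniquely_paired (upper_interval L u)" (is "uniquely_paired ?L'")
    and "bij_betw (\<lambda>j. sup u j) A (join_irreds (upper_interval L u))"
    and "\<forall>j\<in>A. kappa (upper_interval L u) (sup u j) = kappa L j"
proof -
  have cd: "compatibly_dismantlable L" using sd by (simp add: semidistrim_def)
  have up: "uniquely_paired L" by (rule compatibly_dismantlable_imp_uniquely_paired[OF cd])
  have L: "finite_lattice_on L" using up by (simp add: uniquely_paired_def)
  have L': "finite_lattice_on ?L'" by (rule finite_lattice_on_intervals[OF L u])
  have mem: "z \<in> ?L' \<longleftrightarrow> z \<in> L \<and> u \<le> z" for z by (auto simp: upper_interval_def)
  have indep: "j \<le> kappa L j'" if "labelled_cover L y x j" "labelled_cover L y' x j'" "j \<noteq> j'"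
    for x y y' j j' by (rule semidistrimD(1)[OF sd that])
  have cover: "\<exists>z. labelled_cover L z (sup u j) j \<and> u \<le> z" if "j \<in> A" for j
    using cover_with_label[OF cd u, of j] that by (auto simp: A_def labelled_cover_def)
  have A: "j \<in> join_irreds L" "u \<le> kappa L j" "j \<in> L" "kappa L j \<in> L" "\<not> j \<le> kappa L j"
    "sup u j \<in> ?L'" "kappa L j \<in> ?L'" if "j \<in> A" for j
  proof -
    show *: "j \<in> join_irreds L" "u \<le> kappa L j" using that by (auto simp: A_def)
    show **: "j \<in> L" "kappa L j \<in> L"
      using *(1) kappa_inv_props(4)[OF up *(1)] irreds_subset by blast+
    show "\<not> j \<le> kappa L j" using kappa_not_ge[OF up *(1)] .
    show "sup u j \<in> ?L'" using ** u L by (simp add: mem finite_lattice_on_def)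
    show "kappa L j \<in> ?L'" using * ** by (simp add: mem)
  qed
  \<comment> \<open>Let j' label a cover c below \<open>sup u j\<close> with u <= c. If j' is not
    \<open>j\<close>, independence puts \<open>j\<close> below kappa L j', and \<open>u\<close> is
    there too; then j' <= sup u j <= kappa L j', which is impossible. So the label is
    \<open>j\<close> and c <= kappa L j.\<close>
  have below: "z \<le> kappa L j" if j: "j \<in> A" and z: "z \<in> ?L'" "z < sup u j" for j z
  proof -
    obtain c where c: "covered_by ?L' c (sup u j)" "z \<le> c"
      using covered_by_below[OF L' z(1) A(6)[OF j] z(2)] by blast
    then have c': "covered_by L c (sup u j)" "u \<le> c" by (auto simp: covered_by_upper_interval)
    obtain j' where j': "labelled_cover L c (sup u j) j'"
      using cover_label_unique[OF cd c'(1)] c'(1) by (auto simp: labelled_cover_def)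
    have "j' = j"
    proof (rule ccontr)
      assume "j' \<noteq> j"
      then have "j \<le> kappa L j'" using indep cover[OF j] j' by metis
      moreover have "u \<le> kappa L j'" using c' j' by (auto simp: labelled_cover_def)
      ultimately have "sup u j \<le> kappa L j'" by simp
      then have "j' \<le> kappa L j'" using j' unfolding labelled_cover_def by (metis order_trans)
      then show False using kappa_not_ge[OF up] j' by (auto simp: labelled_cover_def)
    qed
    then show ?thesis using c j' by (auto simp: labelled_cover_def)
  qed
  have linked': "linked ?L' (sup u j) (kappa L j)" if j: "j \<in> A" for j
    using A[OF j] below[OF j] uniquely_paired_kappa(2)[OF up A(1)[OF j]]
    by (auto simp: linked_def mem)
  show bij: "bij_betw (\<lambda>j. sup u j) A (join_irreds ?L')"
    unfolding bij_betw_def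
  proof
    \<comment> \<open>If the joins agree, j and j' label covers below the same element, and
      independence would put this element below kappa L j'.\<close>
    show "inj_on (\<lambda>j. sup u j) A"
    proof (rule inj_onI, rule ccontr)
      fix j j' assume j: "j \<in> A" "j' \<in> A" and eq: "sup u j = sup u j'" and "j \<noteq> j'"
      then have "j \<le> kappa L j'" using indep cover[OF j(1)] cover[OF j(2)] by metis
      then have "sup u j \<le> kappa L j'" using A(2)[OF j(2)] by simp
      then show False using eq A(5)[OF j(2)] by simp
    qed
    show "(\<lambda>j. sup u j) ` A = join_irreds ?L'"
    proof (intro set_eqI iffI)
      fix w assume "w \<in> (\<lambda>j. sup u j) ` A"
      then show "w \<in> join_irreds ?L'" using linked_irreds(1)[OF L'] A(6,7) linked' by blast
    next
      fix w assume "w \<in> join_irreds ?L'"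
      then obtain c where w: "w \<in> ?L'" "c \<in> ?L'" "c < w"
        "\<And>z. z \<in> ?L' \<Longrightarrow> z < w \<Longrightarrow> z \<le> c"
        using join_irredE[OF L'] by metis
      then have "covered_by ?L' c w" unfolding covered_by_def by (meson leD)
      then have c: "covered_by L c w" "u \<le> c" by (auto simp: covered_by_upper_interval)
      \<comment> \<open>The preimage of \<open>w\<close> is the label of its only cover in [u,1]:
        \<open>sup u j\<close> is below \<open>w\<close> but not below \<open>c\<close>, which
        bounds everything strictly below \<open>w\<close>.\<close>
      obtain j where j: "j \<in> join_irreds L" "c \<le> kappa L j" "j \<le> w"
        using cover_label_unique[OF cd c(1)] by blast
      then have jA: "j \<in> A" using c by (auto simp: A_def)
      have "sup u j \<le> w" using j w mem by simp
      moreover have "\<not> sup u j \<le> c" using A(5)[OF jA] j(2) by (auto dest: order_trans)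
      ultimately have "w = sup u j" using w(4)[OF A(6)[OF jA]] by (auto simp: less_le)
      then show "w \<in> (\<lambda>j. sup u j) ` A" using jA by blast
    qed
  qed
  \<comment> \<open>A competing pairing of [u,1] can therefore only redistribute the values of
    \<open>kappa L\<close> on \<open>A\<close>, which is what allows it to be extended to a
    bijection for \<open>L\<close>.\<close>
  have Mi: "meet_irreds ?L' = kappa L ` A"
    using uniquely_paired_kappa(1)[OF up]
    by (auto simp: meet_irreds_upper_interval A_def bij_betw_def)
  have inj: "inj_on (kappa L) (join_irreds L)" and img: "kappa L ` join_irreds L = meet_irreds L"
    using uniquely_paired_kappa(1)[OF up] by (auto simp: bij_betw_def)
  have AJ: "A \<subseteq> join_irreds L" by (auto simp: A_def)
  define \<kappa>' where "\<kappa>' = kappa L \<circ> inv_into A (\<lambda>j. sup u j)"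
  have \<kappa>'_sup: "\<kappa>' (sup u j) = kappa L j" if "j \<in> A" for j
    using bij_betw_inv_into_left[OF bij that] by (simp add: \<kappa>'_def)
  have "bij_betw (kappa L) A (kappa L ` A)"
    by (rule inj_on_imp_bij_betw[OF inj_on_subset[OF inj AJ]])
  then have "bij_betw \<kappa>' (join_irreds ?L') (meet_irreds ?L')"
    unfolding \<kappa>'_def Mi by (rule bij_betw_trans[OF bij_betw_inv_into[OF bij]])
  moreover have "linked ?L' w (\<kappa>' w)" if w: "w \<in> join_irreds ?L'" for w
  proof -
    obtain j where "j \<in> A" "w = sup u j" using w bij unfolding bij_betw_def by blast
    then show ?thesis using linked' \<kappa>'_sup by simp
  qed
  moreover have "g w = \<kappa>' w"
    if g: "bij_betw g (join_irreds ?L') (meet_irreds ?L')"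
      "\<And>w. w \<in> join_irreds ?L' \<Longrightarrow> linked ?L' w (g w)" and w: "w \<in> join_irreds ?L'" for g w
  proof -
    \<comment> \<open>Extended by \<^term>\<open>kappa L\<close> outside \<^term>\<open>A\<close>, the competitor becomes a pairing of
      \<^term>\<open>L\<close>.\<close>
    define h where "h j = (if j \<in> A then g (sup u j) else kappa L j)" for j
    have "bij_betw (\<lambda>j. g (sup u j)) A (kappa L ` A)"
      using bij_betw_trans[OF bij g(1)] by (simp add: Mi comp_def)
    then have hA: "bij_betw h A (kappa L ` A)"
      by (rule bij_betw_cong[THEN iffD1, rotated]) (simp add: h_def)
    have "bij_betw (kappa L) (join_irreds L - A) (kappa L ` (join_irreds L - A))"
      by (rule inj_on_imp_bij_betw[OF inj_on_subset[OF inj]]) blast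
    then have hB: "bij_betw h (join_irreds L - A) (kappa L ` (join_irreds L - A))"
      by (rule bij_betw_cong[THEN iffD1, rotated]) (simp add: h_def)
    have disj: "kappa L ` A \<inter> kappa L ` (join_irreds L - A) = {}"
      using inj AJ by (auto dest: inj_onD)
    have "bij_betw h (A \<union> (join_irreds L - A)) (kappa L ` A \<union> kappa L ` (join_irreds L - A))"
      by (rule bij_betw_combine[OF hA hB disj])
    then have hbij: "bij_betw h (join_irreds L) (meet_irreds L)"
      using AJ by (simp add: image_Un[symmetric] Un_absorb1 img)
    have hlinked: "linked L j (h j)" if j: "j \<in> join_irreds L" for j
    proof (cases "j \<in> A")
      case True
      have lk: "linked ?L' (sup u j) (g (sup u j))" and "g (sup u j) \<in> meet_irreds ?L'"
        using g bij_betw_apply[OF bij True] bij_betw_apply[OF g(1)] by auto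
      then have m: "u \<le> g (sup u j)" by (simp add: meet_irreds_upper_interval)
      \<comment> \<open>\<open>kappa L j\<close> bounds \<open>sup u z\<close> but not
        \<open>sup u j\<close>, so the former is strictly smaller and linkedness in [u,1] applies to
        it.\<close>
      have "z \<le> g (sup u j)" if z: "z \<in> L" "z < j" for z
      proof -
        have "z \<le> kappa L j" using uniquely_paired_kappa(2)[OF up j] z by (simp add: linked_def)
        then have "sup u z \<le> kappa L j" using A(2)[OF True] by simp
        then have "sup u z \<noteq> sup u j" using A(5)[OF True] by (metis le_sup_iff)
        moreover have "sup u z \<le> sup u j" using z by (simp add: le_supI2 less_imp_le)
        moreover have "sup u z \<in> ?L'" using z u L by (simp add: mem finite_lattice_on_def)
        ultimately have "sup u z \<le> g (sup u j)"
          using lk unfolding linked_def less_le by blast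
        then show ?thesis by simp
      qed
      moreover have "j \<le> z" if z: "z \<in> L" "g (sup u j) < z" for z
      proof -
        have "u \<le> z" using m z by (meson less_imp_le order_trans)
        then have "sup u j \<le> z" using lk z mem unfolding linked_def by blast
        then show ?thesis by simp
      qed
      moreover have "\<not> j \<le> g (sup u j)" using lk m by (simp add: linked_def)
      ultimately show ?thesis using True by (simp add: linked_def h_def)
    qed (use uniquely_paired_kappa(2)[OF up j] in \<open>simp add: h_def\<close>)
    obtain j where j: "j \<in> A" "w = sup u j" using w bij unfolding bij_betw_def by blast
    have "h j = kappa L j"
      using uniquely_paired_kappa_unique[OF up hbij hlinked] A(1)[OF j(1)] by blast
    then show ?thesis using j \<kappa>'_sup by (simp add: h_def)
  qed
  ultimately have res: "uniquely_paired ?L'" "\<And>w. w \<in> join_irreds ?L' \<Longrightarrow> kappa ?L' w = \<kappa>' w"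
    using uniquely_pairedI[OF L', of \<kappa>'] by blast+
  then show "uniquely_paired ?L'" by blast
  show "\<forall>j\<in>A. kappa ?L' (sup u j) = kappa L j"
    using res(2) bij_betw_apply[OF bij] \<kappa>'_sup by auto
qed

lemma upper_upper_interval: "j \<le> u \<Longrightarrow> upper_interval (upper_interval L j) u = upper_interval L u"
  by (auto simp: upper_interval_def)

text \<open>The induction has to carry independence along with dismantlability, since the pairings
  of [u,1], [sup u j0,1] and [u,m0] are obtained from independence in \<open>L\<close> or in
  [0,m0].\<close>

lemma semidistrim_upper_interval:
  assumes "semidistrim L" "u \<in> L"
  shows "semidistrim (upper_interval L u)"
proof -
  have "compatibly_dismantlable L" using assms(1) by (simp add: semidistrim_def)
  then show ?thesis using assms
  proof (induction arbitrary: u rule: compatibly_dismantlable.induct)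
    case (singleton L)
    then have "upper_interval L u = L"
      by (auto simp: upper_interval_def card_1_singleton_iff)
    then show ?case using singleton by simp
  next
    case (dismantle L j0 m0)
    note up = dismantle.hyps(1) and pp = dismantle.hyps(2)
    note p = prime_pair_linked[OF pp] prime_pair_kappa[OF up pp]
    note sd = dismantle.prems(1) and u = dismantle.prems(2)
    let ?U = "upper_interval L j0" and ?N = "lower_interval L m0" and ?L' = "upper_interval L u"
    have upN: "uniquely_paired ?N"
      by (rule compatibly_dismantlable_imp_uniquely_paired[OF dismantle.hyps(6)])
    have sdU: "semidistrim ?U"
      by (rule semidistrim_upper_intervalI[OF sd dismantle.hyps(3-5)])
    have kN: "kappa ?N j = inf m0 (kappa L j)" if "j \<in> join_irreds L" "j \<le> m0" for j
      by (rule lower_interval_kappa[OF up upN dismantle.hyps(7,8) that])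
    have sdN: "semidistrim ?N"
      by (rule semidistrim_lower_intervalI[OF sd dismantle.hyps(6) kN])
    show ?case
    proof (cases "j0 \<le> u")
      case True
      then have "u \<in> ?U" using u by (simp add: upper_interval_def)
      from dismantle.IH(1)[OF sdU this] show ?thesis using True by (simp add: upper_upper_interval)
    next
      case False
      then have um: "u \<le> m0" using p(5) u by blast
      \<comment> \<open>[u,1] meets [j0,1] in [sup u j0,1] and meets [0,m0] in [u,m0]. Both are
        upper intervals of blocks of the dismantling of \<open>L\<close>, so the induction
        hypotheses apply to them.\<close>
      define j1 where "j1 = sup u j0"
      have j1: "j1 \<in> L" "u \<le> j1" "j0 \<le> j1"
        using up u p(2) by (auto simp: j1_def uniquely_paired_def finite_lattice_on_def)
      have "j1 \<in> ?U" "u \<in> ?N" using j1 um u by (auto simp: upper_interval_def lower_interval_def)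
      have "semidistrim (upper_interval ?U j1)" by (rule dismantle.IH(1)[OF sdU \<open>j1 \<in> ?U\<close>])
      moreover have Ueq: "upper_interval ?U j1 = upper_interval L j1"
        "upper_interval ?L' j1 = upper_interval L j1"
        using j1 by (simp_all add: upper_upper_interval)
      ultimately have cd1: "compatibly_dismantlable (upper_interval ?L' j1)"
        by (simp add: semidistrim_def)
      have Neq: "lower_interval ?L' m0 = upper_interval ?N u"
        by (auto simp: lower_interval_def upper_interval_def)
      have cd2: "compatibly_dismantlable (lower_interval ?L' m0)"
        using dismantle.IH(2)[OF sdN \<open>u \<in> ?N\<close>] Neq by (simp add: semidistrim_def)
      let ?A = "\<lambda>x. {j \<in> join_irreds L. x \<le> kappa L j}"
      note pu = semidistrim_upper_interval_pairing[OF sd u]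
      note p1 = semidistrim_upper_interval_pairing[OF sd j1(1)]
      note pN = semidistrim_upper_interval_pairing[OF sdN \<open>u \<in> ?N\<close>]
      have pp': "prime_pair ?L' j1 m0"
        unfolding prime_pair_def
      proof (intro conjI)
        show "j1 \<in> ?L'" "m0 \<in> ?L'" using j1 um p by (auto simp: upper_interval_def)
        show "?L' = lower_interval ?L' m0 \<union> upper_interval ?L' j1"
          using p(5) by (auto simp: j1_def upper_interval_def lower_interval_def)
        show "lower_interval ?L' m0 \<inter> upper_interval ?L' j1 = {}"
          using p(6) by (auto simp: j1_def upper_interval_def lower_interval_def)
      qed
      have A1: "?A j1 \<subseteq> ?A u" using j1(2) by (auto intro: order_trans)
      have J1: "{w \<in> join_irreds ?L'. j1 \<le> kappa ?L' w} = (\<lambda>j. sup u j) ` ?A j1"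
      proof (intro set_eqI iffI)
        fix w assume "w \<in> {w \<in> join_irreds ?L'. j1 \<le> kappa ?L' w}"
        then have w: "w \<in> join_irreds ?L'" "j1 \<le> kappa ?L' w" by auto
        then obtain j where j: "j \<in> ?A u" "w = sup u j"
          using pu(2) unfolding bij_betw_def by blast
        then have "kappa ?L' w = kappa L j" using pu(3) by blast
        then have "j \<in> ?A j1" using j w by auto
        then show "w \<in> (\<lambda>j. sup u j) ` ?A j1" using j by blast
      next
        fix w assume "w \<in> (\<lambda>j. sup u j) ` ?A j1"
        then obtain j where j: "j \<in> ?A j1" "w = sup u j" by blast
        then have jA: "j \<in> ?A u" using A1 by blast
        then have "kappa ?L' w = kappa L j" using j pu(3) by blast
        then show "w \<in> {w \<in> join_irreds ?L'. j1 \<le> kappa ?L' w}"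
          using j bij_betw_apply[OF pu(2) jA] by auto
      qed
      \<comment> \<open>So j -> sup j1 j, a bijection by \<open>p1\<close>, is j -> sup u j followed
        by w -> sup j1 w. The first map is onto the set in \<open>J1\<close>, so the second is a
        bijection from there.\<close>
      have sup_sup: "sup j1 (sup u j) = sup j1 j" for j
        using j1(2) by (simp add: sup.assoc[symmetric] sup.absorb1)
      have b1: "bij_betw (\<lambda>w. sup j1 w) {w \<in> join_irreds ?L'. j1 \<le> kappa ?L' w}
          (join_irreds (upper_interval ?L' j1))"
      proof -
        have "inj_on (\<lambda>w. sup j1 w) ((\<lambda>j. sup u j) ` ?A j1)"
        proof (rule inj_onI)
          fix w w' assume "w \<in> (\<lambda>j. sup u j) ` ?A j1" "w' \<in> (\<lambda>j. sup u j) ` ?A j1"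
            and eq: "sup j1 w = sup j1 w'"
          then obtain j j' where j: "j \<in> ?A j1" "j' \<in> ?A j1" "w = sup u j" "w' = sup u j'" by blast
          then have "sup j1 j = sup j1 j'" using eq by (simp add: sup_sup)
          then have "j = j'" using p1(2) j(1,2) unfolding bij_betw_def by (blast dest: inj_onD)
          then show "w = w'" using j by simp
        qed
        moreover have "(\<lambda>w. sup j1 w) ` (\<lambda>j. sup u j) ` ?A j1 = join_irreds (upper_interval L j1)"
          using p1(2) by (simp add: bij_betw_def image_image sup_sup)
        ultimately show ?thesis unfolding J1 Ueq by (simp add: bij_betw_def)
      qed
      have k1: "\<forall>w\<in>{w \<in> join_irreds ?L'. j1 \<le> kappa ?L' w}.
          kappa (upper_interval ?L' j1) (sup j1 w) = kappa ?L' w"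
      proof
        fix w assume "w \<in> {w \<in> join_irreds ?L'. j1 \<le> kappa ?L' w}"
        then obtain j where j: "j \<in> ?A j1" "w = sup u j" unfolding J1 by blast
        then have "kappa ?L' w = kappa L j" using pu(3) A1 by blast
        moreover have "kappa (upper_interval L j1) (sup j1 j) = kappa L j" using p1(3) j(1) by blast
        ultimately show "kappa (upper_interval ?L' j1) (sup j1 w) = kappa ?L' w"
          unfolding Ueq j(2) by (simp add: sup_sup)
      qed
      have kinv: "kappa_inv ?L' m = sup u (kappa_inv L m)" if m: "m \<in> meet_irreds L" "u \<le> m" for m
      proof -
        have jA: "kappa_inv L m \<in> ?A u" using kappa_inv_props[OF up] m by auto
        then have "kappa ?L' (sup u (kappa_inv L m)) = m"
          using pu(3) kappa_inv_props(2)[OF up m(1)] by auto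
        moreover have "sup u (kappa_inv L m) \<in> join_irreds ?L'" using bij_betw_apply[OF pu(2) jA] .
        ultimately show ?thesis using kappa_inv_props(3)[OF pu(1)] by metis
      qed
      let ?B = "{m \<in> meet_irreds L. kappa_inv L m \<le> m0}"
      \<comment> \<open>The inverse pairing of [u,1] sends \<open>m\<close> to
        \<open>sup u (kappa_inv L m)\<close>, which is below \<open>m0\<close> exactly when
        \<open>kappa_inv L m\<close> is, because u <= m0. Thus the map of condition (ii) for [u,1]
        restricts that for \<open>L\<close>.\<close>
      have M2: "{m \<in> meet_irreds ?L'. kappa_inv ?L' m \<le> m0} = {m \<in> ?B. u \<le> inf m0 m}"
        using um kinv by (auto simp: meet_irreds_upper_interval)
      have b2: "bij_betw (\<lambda>m. inf m0 m) {m \<in> meet_irreds ?L'. kappa_inv ?L' m \<le> m0}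
          (meet_irreds (lower_interval ?L' m0))"
        unfolding M2 unfolding Neq meet_irreds_upper_interval bij_betw_def
      proof
        show "inj_on (\<lambda>m. inf m0 m) {m \<in> ?B. u \<le> inf m0 m}"
          by (rule inj_on_subset[OF bij_betw_imp_inj_on[OF dismantle.hyps(7)]]) blast
        show "(\<lambda>m. inf m0 m) ` {m \<in> ?B. u \<le> inf m0 m} = {m \<in> meet_irreds ?N. u \<le> m}"
          unfolding bij_betw_imp_surj_on[OF dismantle.hyps(7), symmetric] by blast
      qed
      \<comment> \<open>Both inverse pairings give \<open>sup u (kappa_inv L m)\<close>: that of
        [u,m0] is computed inside [0,m0] by \<open>pN\<close>, that of [u,1] inside \<open>L\<close>
        by \<open>kinv\<close>.\<close>
      have k2: "\<forall>m\<in>{m \<in> meet_irreds ?L'. kappa_inv ?L' m \<le> m0}.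
          kappa_inv (lower_interval ?L' m0) (inf m0 m) = kappa_inv ?L' m"
      proof
        fix m assume "m \<in> {m \<in> meet_irreds ?L'. kappa_inv ?L' m \<le> m0}"
        then have m: "m \<in> meet_irreds L" "kappa_inv L m \<le> m0" "u \<le> inf m0 m" unfolding M2 by auto
        let ?j = "kappa_inv L m"
        have j: "?j \<in> join_irreds L" "kappa L ?j = m" using kappa_inv_props[OF up] m by auto
        have jN: "?j \<in> {j \<in> join_irreds ?N. u \<le> kappa ?N j}"
          using j m kN by (auto simp: join_irreds_lower_interval)
        then have "kappa (upper_interval ?N u) (sup u ?j) = inf m0 m"
          using pN(3) kN[OF j(1) m(2)] j by auto
        moreover have "sup u ?j \<in> join_irreds (upper_interval ?N u)"
          using bij_betw_apply[OF pN(2) jN] .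
        ultimately have "kappa_inv (upper_interval ?N u) (inf m0 m) = sup u ?j"
          using kappa_inv_props(3)[OF pN(1)] by metis
        then show "kappa_inv (lower_interval ?L' m0) (inf m0 m) = kappa_inv ?L' m"
          using kinv m by (simp add: Neq)
      qed
      have "compatibly_dismantlable ?L'"
        by (rule compatibly_dismantlable.dismantle[OF pu(1) pp' cd1 b1 k1 cd2 b2 k2])
      then show ?thesis by (rule semidistrim_upper_intervalI[OF sd _ pu(2,3)])
    qed
  qed
qed


section \<open>Order duality\<close>

text \<open>Two types are involved because order reversal leads into the type \<open>dual\<close>
  and back. Surjectivity onto the whole type makes \<open>f\<close> exchange \<open>sup\<close> and
  \<open>inf\<close>.\<close>

locale lattice_anti_isomorphism =
  fixes f :: "'a::lattice \<Rightarrow> 'b::lattice"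
  assumes le_iff [simp]: "f x \<le> f y \<longleftrightarrow> y \<le> x"
    and surj: "surj f"
begin

lemma image_eq_iff [simp]: "f x = f y \<longleftrightarrow> x = y"
  by (simp add: order.eq_iff conj_commute)

lemma image_less_iff [simp]: "f x < f y \<longleftrightarrow> y < x"
  by (simp add: less_le_not_le)

lemma bij: "bij f"
  using surj by (auto simp: bij_def inj_def)

lemma inj_on: "inj_on f A"
  by (simp add: inj_on_def)

lemma mem_image_iff [simp]: "f x \<in> f ` A \<longleftrightarrow> x \<in> A"
  by auto

lemma inv_f [simp]: "inv f (f x) = x" "f (inv f y) = y"
  using bij by (simp_all add: bij_is_inj bij_is_surj surj_f_inv_f)

lemma ex1_iff: "(\<exists>!y. P y) \<longleftrightarrow> (\<exists>!x. P (f x))"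
  by (metis inv_f)

lemma sup_eq: "sup (f x) (f y) = f (inf x y)"
proof (rule order.antisym)
  obtain s where s: "sup (f x) (f y) = f s" using inv_f(2) by metis
  then have "s \<le> x" "s \<le> y" by (metis le_iff sup_ge1, metis le_iff sup_ge2)
  then show "f (inf x y) \<le> sup (f x) (f y)" by (simp add: s)
qed simp

lemma inf_eq: "inf (f x) (f y) = f (sup x y)"
proof (rule order.antisym)
  obtain s where s: "inf (f x) (f y) = f s" using inv_f(2) by metis
  then have "x \<le> s" "y \<le> s" by (metis le_iff inf_le1, metis le_iff inf_le2)
  then show "inf (f x) (f y) \<le> f (sup x y)" by (simp add: s)
qed simp

lemma finite_lattice_on_image: "finite_lattice_on L \<Longrightarrow> finite_lattice_on (f ` L)"
  by (auto simp: finite_lattice_on_def sup_eq inf_eq)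

lemma covered_by_image: "covered_by (f ` L) (f x) (f y) \<longleftrightarrow> covered_by L y x"
  by (auto simp: covered_by_def)

lemma join_irreds_image: "join_irreds (f ` L) = f ` meet_irreds L"
  by (auto simp: join_irreds_def meet_irreds_def ex1_iff covered_by_image)

lemma meet_irreds_image: "meet_irreds (f ` L) = f ` join_irreds L"
  by (auto simp: join_irreds_def meet_irreds_def ex1_iff covered_by_image)

lemma linked_image: "linked (f ` L) (f m) (f j) \<longleftrightarrow> linked L j m"
  by (auto simp: linked_def)

lemma interval_images:
  "upper_interval (f ` L) (f v) = f ` lower_interval L v"
  "lower_interval (f ` L) (f v) = f ` upper_interval L v"
  by (auto simp: upper_interval_def lower_interval_def)

lemma bij_betw_conjugate:
  assumes "bij_betw g A B" "\<And>x. x \<in> A \<Longrightarrow> h (f x) = f (g x)"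
  shows "bij_betw h (f ` A) (f ` B)"
proof -
  have "bij_betw (h \<circ> f) A (f ` B)"
    using bij_betw_trans[OF assms(1) inj_on_imp_bij_betw[OF inj_on]] assms(2)
    by (subst bij_betw_cong[where g = "f \<circ> g"]) auto
  then show ?thesis
    using bij_betw_comp_iff[OF inj_on_imp_bij_betw[OF inj_on]] by blast
qed

text \<open>\<open>f\<close> preserves \<open>linked\<close> with its arguments swapped, so the
  pairing of the image is the inverse pairing of \<open>L\<close>, conjugated by
  \<open>f\<close>.\<close>

lemma uniquely_paired_image:
  assumes up: "uniquely_paired L"
  shows "uniquely_paired (f ` L)"
    and "m \<in> meet_irreds L \<Longrightarrow> kappa (f ` L) (f m) = f (kappa_inv L m)"
    and "j \<in> join_irreds L \<Longrightarrow> kappa_inv (f ` L) (f j) = f (kappa L j)"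
proof -
  have L: "finite_lattice_on (f ` L)"
    using up finite_lattice_on_image by (auto simp: uniquely_paired_def)
  let ?k = "\<lambda>y. f (kappa_inv L (inv f y))"
  have bij_inv: "bij_betw (kappa_inv L) (meet_irreds L) (join_irreds L)"
    unfolding kappa_inv_def by (rule bij_betw_inv_into[OF uniquely_paired_kappa(1)[OF up]])
  have b: "bij_betw ?k (join_irreds (f ` L)) (meet_irreds (f ` L))"
    unfolding join_irreds_image meet_irreds_image by (rule bij_betw_conjugate[OF bij_inv]) simp
  have l: "linked (f ` L) w (?k w)" if "w \<in> join_irreds (f ` L)" for w
    using that uniquely_paired_kappa(2)[OF up] kappa_inv_props[OF up]
    unfolding join_irreds_image by (auto simp: linked_image) metis
  have u: "g w = ?k w"
    if g: "bij_betw g (join_irreds (f ` L)) (meet_irreds (f ` L))"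
      "\<And>w. w \<in> join_irreds (f ` L) \<Longrightarrow> linked (f ` L) w (g w)"
      and w: "w \<in> join_irreds (f ` L)" for g w
  proof -
    \<comment> \<open>The competitor pulled back to \<open>L\<close> maps meet-irreducibles to
      join-irreducibles; its inverse is a pairing of \<open>L\<close>, hence
      \<open>kappa L\<close>.\<close>
    define h where "h m = inv f (g (f m))" for m
    have "bij_betw (g \<circ> f) (meet_irreds L) (f ` join_irreds L)"
      using bij_betw_trans[OF inj_on_imp_bij_betw[OF inj_on] g(1)[unfolded join_irreds_image]]
      by (simp add: meet_irreds_image)
    moreover have "bij_betw (inv f) (f ` join_irreds L) (join_irreds L)"
      by (rule bij_betw_byWitness[where f' = f]) auto
    ultimately have "bij_betw (inv f \<circ> (g \<circ> f)) (meet_irreds L) (join_irreds L)"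
      by (rule bij_betw_trans)
    then have h: "bij_betw h (meet_irreds L) (join_irreds L)"
      by (simp add: h_def comp_def cong: bij_betw_cong)
    have hl: "linked L (h m) m" if "m \<in> meet_irreds L" for m
      using g(2)[of "f m"] that linked_image[of L m "h m"] by (simp add: h_def join_irreds_image)
    let ?i = "inv_into (meet_irreds L) h"
    have "linked L j (?i j)" if "j \<in> join_irreds L" for j
      using hl[of "?i j"] that h by (metis bij_betw_apply bij_betw_inv_into bij_betw_inv_into_right)
    then have k: "?i j = kappa L j" if "j \<in> join_irreds L" for j
      using uniquely_paired_kappa_unique[OF up bij_betw_inv_into[OF h]] that by blast
    obtain m where m: "m \<in> meet_irreds L" "w = f m" using w by (auto simp: join_irreds_image)
    have "kappa L (h m) = m" "h m \<in> join_irreds L"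
      using k[of "h m"] m h by (auto simp: bij_betw_inv_into_left bij_betw_apply)
    then have "kappa_inv L m = h m" using kappa_inv_props(3)[OF up, of "h m"] by simp
    then show ?thesis using m by (simp add: h_def)
  qed
  have *: "uniquely_paired (f ` L)"
    "\<And>w. w \<in> join_irreds (f ` L) \<Longrightarrow> kappa (f ` L) w = ?k w"
    using uniquely_pairedI[of "f ` L" ?k, OF L b] l u by blast+
  show up': "uniquely_paired (f ` L)" by (rule *(1))
  have k: "kappa (f ` L) (f m) = f (kappa_inv L m)" if "m \<in> meet_irreds L" for m
    using *(2)[of "f m"] that by (simp add: join_irreds_image)
  then show "m \<in> meet_irreds L \<Longrightarrow> kappa (f ` L) (f m) = f (kappa_inv L m)" .
  show "kappa_inv (f ` L) (f j) = f (kappa L j)" if "j \<in> join_irreds L"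
    using k[of "kappa L j"] kappa_inv_props[OF up] that
      kappa_inv_props(3)[OF up', of "f (kappa L j)"] by (simp add: join_irreds_image)
qed

text \<open>The reversed prime pair is (f m0, f j0), and conditions (i) and (ii) trade
  places.\<close>

lemma compatibly_dismantlable_image:
  "compatibly_dismantlable L \<Longrightarrow> compatibly_dismantlable (f ` L)"
proof (induction rule: compatibly_dismantlable.induct)
  case (singleton L)
  then show ?case
    using uniquely_paired_image(1) card_image[OF inj_on] by (metis compatibly_dismantlable.singleton)
next
  case (dismantle L j0 m0)
  note up = dismantle.hyps(1)
  have upU: "uniquely_paired (upper_interval L j0)" and upN: "uniquely_paired (lower_interval L m0)"
    using dismantle.hyps compatibly_dismantlable_imp_uniquely_paired by blast+
  note im = uniquely_paired_image[OF up]
  have pp: "prime_pair (f ` L) (f m0) (f j0)"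
    using dismantle.hyps(2) unfolding prime_pair_def interval_images
    by (auto simp flip: image_Un image_Int[OF bij_is_inj[OF bij]])
  have M: "{w \<in> join_irreds (f ` L). f m0 \<le> kappa (f ` L) w} =
      f ` {m \<in> meet_irreds L. kappa_inv L m \<le> m0}"
    using im(2) by (auto simp: join_irreds_image)
  have J: "{w \<in> meet_irreds (f ` L). kappa_inv (f ` L) w \<le> f j0} =
      f ` {j \<in> join_irreds L. j0 \<le> kappa L j}"
    using im(3) by (auto simp: meet_irreds_image)
  show ?case
  proof (rule compatibly_dismantlable.dismantle[OF im(1) pp])
    show "bij_betw (sup (f m0)) {w \<in> join_irreds (f ` L). f m0 \<le> kappa (f ` L) w}
        (join_irreds (upper_interval (f ` L) (f m0)))"
      unfolding M unfolding interval_images join_irreds_image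
      by (rule bij_betw_conjugate[OF dismantle.hyps(7)]) (rule sup_eq)
    show "bij_betw (inf (f j0)) {w \<in> meet_irreds (f ` L). kappa_inv (f ` L) w \<le> f j0}
        (meet_irreds (lower_interval (f ` L) (f j0)))"
      unfolding J unfolding interval_images meet_irreds_image
      by (rule bij_betw_conjugate[OF dismantle.hyps(4)]) (rule inf_eq)
    show "\<forall>w\<in>{w \<in> join_irreds (f ` L). f m0 \<le> kappa (f ` L) w}.
        kappa (upper_interval (f ` L) (f m0)) (sup (f m0) w) = kappa (f ` L) w"
      unfolding M interval_images
      using uniquely_paired_image(2)[OF upN bij_betw_apply[OF dismantle.hyps(7)]]
        dismantle.hyps(8) im(2) by (simp add: sup_eq)
    show "\<forall>w\<in>{w \<in> meet_irreds (f ` L). kappa_inv (f ` L) w \<le> f j0}.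
        kappa_inv (lower_interval (f ` L) (f j0)) (inf (f j0) w) = kappa_inv (f ` L) w"
      unfolding J interval_images
      using uniquely_paired_image(3)[OF upU bij_betw_apply[OF dismantle.hyps(4)]]
        dismantle.hyps(5) im(3) by (simp add: inf_eq)
  qed (simp_all add: interval_images dismantle.IH)
qed

lemma semidistrim_image:
  assumes "semidistrim L"
  shows "semidistrim (f ` L)"
proof -
  have cd: "compatibly_dismantlable L" using assms by (simp add: semidistrim_def)
  have up: "uniquely_paired L" by (rule compatibly_dismantlable_imp_uniquely_paired[OF cd])
  have lab: "\<exists>m. w = f m \<and> m \<in> meet_irreds L \<and> labelled_cover L y x (kappa_inv L m)"
    if "labelled_cover (f ` L) (f x) (f y) w" for x y w
  proof -
    from that obtain m where "m \<in> meet_irreds L" "w = f m"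
      by (auto simp: labelled_cover_def join_irreds_image)
    then show ?thesis
      using that uniquely_paired_image(2)[OF up] kappa_inv_props[OF up]
      by (auto simp: labelled_cover_def covered_by_image)
  qed
  have le: "f m \<le> kappa (f ` L) (f m')"
    if "m \<in> meet_irreds L" "m' \<in> meet_irreds L" "f m \<noteq> f m'"
      "kappa_inv L m' \<noteq> kappa_inv L m \<Longrightarrow> kappa_inv L m' \<le> kappa L (kappa_inv L m)" for m m'
  proof -
    have "kappa_inv L m' \<noteq> kappa_inv L m"
      using that(1-3) kappa_inv_props(2)[OF up] by metis
    then show ?thesis
      using that uniquely_paired_image(2)[OF up] kappa_inv_props(2)[OF up] by simp
  qed
  show ?thesis
    unfolding semidistrim_iff
  proof (intro conjI allI impI)
    fix x y y' w w'
    assume w: "labelled_cover (f ` L) y x w" "labelled_cover (f ` L) y' x w'" "w \<noteq> w'"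
    obtain a b b' where [simp]: "x = f a" "y = f b" "y' = f b'" using inv_f(2) by metis
    from lab[of b a w] w(1) obtain m where m: "w = f m" "m \<in> meet_irreds L"
      "labelled_cover L a b (kappa_inv L m)" by auto
    from lab[of b' a w'] w(2) obtain m' where m': "w' = f m'" "m' \<in> meet_irreds L"
      "labelled_cover L a b' (kappa_inv L m')" by auto
    show "w \<le> kappa (f ` L) w'"
      using le[OF m(2) m'(2)] w(3) semidistrimD(2)[OF assms m'(3) m(3)] m(1) m'(1) by blast
  next
    fix x y y' w w'
    assume w: "labelled_cover (f ` L) x y w" "labelled_cover (f ` L) x y' w'" "w \<noteq> w'"
    obtain a b b' where [simp]: "x = f a" "y = f b" "y' = f b'" using inv_f(2) by metis
    from lab[of a b w] w(1) obtain m where m: "w = f m" "m \<in> meet_irreds L"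
      "labelled_cover L b a (kappa_inv L m)" by auto
    from lab[of a b' w'] w(2) obtain m' where m': "w' = f m'" "m' \<in> meet_irreds L"
      "labelled_cover L b' a (kappa_inv L m')" by auto
    show "w \<le> kappa (f ` L) w'"
      using le[OF m(2) m'(2)] w(3) semidistrimD(1)[OF assms m'(3) m(3)] m(1) m'(1) by blast
  qed (rule compatibly_dismantlable_image[OF cd])
qed

end

text \<open>The interval becomes an upper one under \<open>dual\<close>, and \<open>undual\<close>
  brings the conclusion back; hence the two interpretations.\<close>

lemma semidistrim_lower_interval:
  assumes "semidistrim L" "v \<in> L"
  shows "semidistrim (lower_interval L v)"
proof -
  interpret d: lattice_anti_isomorphism dual
    by standard (simp_all add: surj_dual)
  interpret u: lattice_anti_isomorphism undual
    by standard (simp_all add: surj_undual dual_less_eq_iff)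
  have "semidistrim (upper_interval (dual ` L) (dual v))"
    using semidistrim_upper_interval[OF d.semidistrim_image[OF assms(1)]] assms(2) by simp
  then have "semidistrim (undual ` dual ` lower_interval L v)"
    unfolding d.interval_images by (rule u.semidistrim_image)
  then show ?thesis by (simp add: image_comp)
qed

theorem theorem7p8:
  fixes L :: "'a::lattice set" and u v :: 'a
  assumes "semidistrim L"
    and "u \<in> L" and "v \<in> L" and "u \<le> v"
  shows "semidistrim (interval_on L u v)"
proof -
  have "interval_on L u v = upper_interval (lower_interval L v) u"
    by (auto simp: interval_on_def upper_interval_def lower_interval_def)
  moreover have "u \<in> lower_interval L v" using assms by (simp add: lower_interval_def)
  ultimately show ?thesis
    using semidistrim_upper_interval[OF semidistrim_lower_interval[OF assms(1,3)]] by simp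
qed

end
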